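(* Let $z_1,z_2,\ldots,z_n$ be $n$, not necessarily distinct, complex numbers, and let $\gamma_1,\ldots,\gamma_n$ be nonnegative real numbers with $\sum_{k=1}^n\gamma_k=1$. Then all the zeros of the polynomial $A_n^\gamma(z)=\sum_{k=1}^n\gamma_k g_k(z)$ lie in the union of the discs $$\bigcup_{j=1}^n\left\{z\in\mathbb{C} : \left|z-[(1-\gamma_j)z_j+\gamma_j z_n]\right|\le (n-2)\gamma_j\left|z_n-z_j\right|\right\}.$$
   Context: The incomplete polynomials associated with $z_1,\ldots,z_n$ are $g_k(z)=\prod_{j=1,\,j\ne k}^n(z-z_j)$, $1\le k\le n$. *)

theory Defs
  imports Complex_Main "HOL-Computational_Algebra.Polynomial"
begin

definition incomplete_poly :: "nat \<Rightarrow> (nat \<Rightarrow> complex) \<Rightarrow> nat \<Rightarrow> complex poly" where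
  "incomplete_poly n z k = (\<Prod>j\<in>{1..n} - {k}. [:- z j, 1:])"

definition weighted_incomplete_sum ::
    "nat \<Rightarrow> (nat \<Rightarrow> real) \<Rightarrow> (nat \<Rightarrow> complex) \<Rightarrow> complex poly" where
  "weighted_incomplete_sum n \<gamma> z =
     (\<Sum>k=1..n. smult (complex_of_real (\<gamma> k)) (incomplete_poly n z k))"

end

(* For a zero w distinct from all the nodes, the numbers x_k = \<gamma>_k (z_n - z_k) / (w - z_k), k < n, sum to 1.
   They form an eigenvector, with eigenvalue w, of the matrix of order n - 1 with diagonal entries
   (1 - \<gamma>_j) z_j + \<gamma>_j z_n and all other entries of row j equal to \<gamma>_j (z_n - z_j).  The discs are the
   Gershgorin discs of this matrix, and j is found as an index at which |x_j| is maximal. *)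
theory Submission imports Defs begin

lemma poly_weighted_incomplete_sum:
  "poly (weighted_incomplete_sum n \<gamma> z) w =
     (\<Sum>k=1..n. complex_of_real (\<gamma> k) * (\<Prod>j\<in>{1..n} - {k}. w - z j))"
  by (simp add: weighted_incomplete_sum_def incomplete_poly_def poly_sum poly_prod)

text \<open>Away from the nodes each g_k is the full product divided by w - z_k. As that product
  does not vanish there, a zero of the polynomial is a zero of the sum of partial fractions.\<close>

lemma poly_weighted_incomplete_sum_nonnode:
  assumes "\<And>k. k \<in> {1..n} \<Longrightarrow> w \<noteq> z k"
  shows "poly (weighted_incomplete_sum n \<gamma> z) w =
     (\<Prod>j\<in>{1..n}. w - z j) * (\<Sum>k=1..n. complex_of_real (\<gamma> k) / (w - z k))"
proof -
  have "(\<Prod>j\<in>{1..n} - {k}. w - z j) = (\<Prod>j\<in>{1..n}. w - z j) / (w - z k)"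
    if "k \<in> {1..n}" for k
    using assms[OF that] prod.remove[OF finite_atLeastAtMost that, of "\<lambda>j. w - z j"] by simp
  then show ?thesis
    unfolding poly_weighted_incomplete_sum sum_distrib_left by (intro sum.cong) auto
qed

theorem theorem6p6:
  fixes n :: nat and z :: "nat \<Rightarrow> complex" and \<gamma> :: "nat \<Rightarrow> real"
  assumes "\<And>k. k \<in> {1..n} \<Longrightarrow> 0 \<le> \<gamma> k"
    and "(\<Sum>k=1..n. \<gamma> k) = 1"
  shows "{w. poly (weighted_incomplete_sum n \<gamma> z) w = 0} \<subseteq>
    (\<Union>j\<in>{1..n}. {w. cmod (w - ((1 - complex_of_real (\<gamma> j)) * z j + complex_of_real (\<gamma> j) * z n))
                        \<le> (real n - 2) * \<gamma> j * cmod (z n - z j)})"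
proof
  fix w assume "w \<in> {w. poly (weighted_incomplete_sum n \<gamma> z) w = 0}"
  then have zero: "poly (weighted_incomplete_sum n \<gamma> z) w = 0" by simp
  have n0: "n \<in> {1..n}" using assms(2) by (cases "n = 0") auto
  have sum1: "(\<Sum>k=1..n. complex_of_real (\<gamma> k)) = 1"
    using assms(2) by (metis of_real_1 of_real_sum)
  have "\<exists>j\<in>{1..n}. cmod (w - z j - complex_of_real (\<gamma> j) * (z n - z j))
      \<le> (real n - 2) * \<gamma> j * cmod (z n - z j)"
  \<comment> \<open>The numbers x_k divide by w - z_k, so a zero that is itself a node is treated
    separately.\<close>
  proof (cases "\<exists>j\<in>{1..n}. w = z j")
    case True
    then obtain j where j: "j \<in> {1..n}" "w = z j" by blast
    show ?thesis
    proof (cases "z j = z n")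
      case True
      \<comment> \<open>The disc of index n degenerates to the single point z_n, which is w.\<close>
      with j n0 show ?thesis by (intro bexI[of _ n]) auto
    next
      case False
      with j have "j < n" "1 \<le> j" by (auto simp: nat_less_le)
      then consider "n = 2" "j = 1" | "n \<ge> 3" by linarith
      \<comment> \<open>Here w = z_j lies at distance \<gamma>_j |z_n - z_j| from the centre of its
        disc, so comparing the factors suffices. Only n = 2 is delicate: there the value at z_1 is
        \<gamma>_1 (z_1 - z_2), and its vanishing forces \<gamma>_1 = 0.\<close>
      then have "\<gamma> j \<le> (real n - 2) * \<gamma> j"
      proof cases
        case 1
        have "{1..2::nat} - {1} = {2}" "{1..2::nat} - {2} = {1}" by auto
        moreover have "{1..2::nat} = {1, 2}" by auto
        ultimately show ?thesis
          using zero j False 1 by (simp add: poly_weighted_incomplete_sum)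
      next
        case 2
        with assms(1)[OF j(1)] mult_right_mono[of 1 "real n - 2" "\<gamma> j"] show ?thesis by simp
      qed
      then show ?thesis
        using j assms(1)[OF j(1)]
        by (intro bexI[of _ j]) (auto simp: norm_mult intro: mult_right_mono)
    qed
  next
    case False
    then have ne: "\<And>k. k \<in> {1..n} \<Longrightarrow> w \<noteq> z k" by blast
    define x where "x k = complex_of_real (\<gamma> k) * (z n - z k) / (w - z k)" for k
    define K where "K = {1..n} - {n}"
    have K: "finite K" "card K = n - 1" using n0 by (simp_all add: K_def)
    have "(\<Sum>k=1..n. complex_of_real (\<gamma> k) / (w - z k)) = 0"
      using zero ne poly_weighted_incomplete_sum_nonnode[OF ne] by auto
    \<comment> \<open>Write z_n - z_k = (w - z_k) - (w - z_n). On summation the second part vanishes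
      because w is a zero, and the weights leave 1.\<close>
    moreover have "x k = complex_of_real (\<gamma> k) - (w - z n) * (complex_of_real (\<gamma> k) / (w - z k))"
      if "k \<in> {1..n}" for k
      using ne[OF that] by (simp add: x_def field_simps)
    then have "sum x {1..n} = (\<Sum>k=1..n. complex_of_real (\<gamma> k))
        - (w - z n) * (\<Sum>k=1..n. complex_of_real (\<gamma> k) / (w - z k))"
      unfolding sum_distrib_left sum_subtractf[symmetric] by (rule sum.cong[OF refl])
    ultimately have "sum x {1..n} = 1" using sum1 by simp
    then have sumK: "sum x K = 1"
      using sum.remove[OF finite_atLeastAtMost n0, of x] by (simp add: K_def x_def)
    then have "K \<noteq> {}" by auto
    with K have "Max ((cmod \<circ> x) ` K) \<in> (cmod \<circ> x) ` K" by (intro Max_in) auto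
    then obtain j where j: "j \<in> K" and "cmod (x j) = Max ((cmod \<circ> x) ` K)" by auto
    then have max: "cmod (x k) \<le> cmod (x j)" if "k \<in> K" for k
      using K that by auto
    have xj: "x j \<noteq> 0"
    proof
      assume "x j = 0"
      then have "sum x K = 0" using max by (intro sum.neutral) auto
      with sumK show False by simp
    qed
    have jn: "j \<in> {1..n}" using j by (simp add: K_def)
    \<comment> \<open>Nonemptiness of \<open>K\<close> excludes n = 1, so the truncated subtractions
      in the cardinalities agree with the real n - 2.\<close>
    have "card K \<ge> 1" using K(1) \<open>K \<noteq> {}\<close> by (simp add: Suc_le_eq card_gt_0_iff)
    then have card: "real (card (K - {j})) = real n - 2" using K j by (simp add: of_nat_diff)
    have rest: "sum x (K - {j}) = 1 - x j" using sumK K j by (simp add: sum_diff1)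
    have "cmod (sum x (K - {j})) \<le> (\<Sum>k\<in>K - {j}. cmod (x j))"
      by (rule sum_norm_le) (use max in auto)
    then have bound: "cmod (1 - x j) \<le> (real n - 2) * cmod (x j)"
      using card rest by simp
    \<comment> \<open>Row j of the eigenvector equation: (w - z_j) x_j = \<gamma>_j (z_n - z_j) with
      the diagonal term moved to the left; 1 - x_j is the sum of the other entries.\<close>
    have "(w - z j - complex_of_real (\<gamma> j) * (z n - z j)) * x j
        = complex_of_real (\<gamma> j) * (z n - z j) * (1 - x j)"
      using ne[OF jn] by (simp add: x_def field_simps)
    then have "cmod (w - z j - complex_of_real (\<gamma> j) * (z n - z j)) * cmod (x j)
        = \<gamma> j * cmod (z n - z j) * cmod (1 - x j)"
      using assms(1)[OF jn] by (metis abs_of_nonneg norm_mult norm_of_real)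
    also have "\<dots> \<le> \<gamma> j * cmod (z n - z j) * ((real n - 2) * cmod (x j))"
      using bound assms(1)[OF jn] by (intro mult_left_mono) auto
    also have "\<dots> = (real n - 2) * \<gamma> j * cmod (z n - z j) * cmod (x j)"
      by (simp only: ac_simps)
    finally have "cmod (w - z j - complex_of_real (\<gamma> j) * (z n - z j))
        \<le> (real n - 2) * \<gamma> j * cmod (z n - z j)"
      by (rule mult_right_le_imp_le) (use xj in simp)
    with jn show ?thesis by blast
  qed
  then show "w \<in> (\<Union>j\<in>{1..n}. {w. cmod (w - ((1 - complex_of_real (\<gamma> j)) * z j + complex_of_real (\<gamma> j) * z n))
                        \<le> (real n - 2) * \<gamma> j * cmod (z n - z j)})"
    by (simp add: algebra_simps)
qed

end
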